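(* Every locally out-transitive oriented graph has dichromatic number at most 2.
   Context: An oriented graph is a digraph with no loops, no parallel arcs and no pair of opposite arcs. It is locally out-transitive if the out-neighbourhood of every vertex induces a transitive (i.e. acyclic) tournament. The dichromatic number is the least number of parts in a partition of the vertex set into sets inducing acyclic subdigraphs. *)

theory Defs
  imports
    "Graph_Theory.Digraph_Component"
    "HOL-Library.Disjoint_Sets"
    "HOL-Library.Extended_Nat"
begin

(* Neither the vertex set nor the arc set is required to be finite. *)

locale oriented_graph = loopfree_digraph + nomulti_digraph +
  assumes no_opposite_arcs: "u \<rightarrow>\<^bsub>G\<^esub> v \<Longrightarrow> \<not> v \<rightarrow>\<^bsub>G\<^esub> u"

definition acyclic_digraph :: "('a, 'b) pre_digraph \<Rightarrow> bool" where
  "acyclic_digraph G \<longleftrightarrow> (\<nexists>p. pre_digraph.cycle G p)"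

definition tournament :: "('a, 'b) pre_digraph \<Rightarrow> bool" where
  "tournament G \<longleftrightarrow> oriented_graph G \<and>
     (\<forall>u\<in>verts G. \<forall>v\<in>verts G. u \<noteq> v \<longrightarrow> u \<rightarrow>\<^bsub>G\<^esub> v \<or> v \<rightarrow>\<^bsub>G\<^esub> u)"

definition transitive_tournament :: "('a, 'b) pre_digraph \<Rightarrow> bool" where
  "transitive_tournament G \<longleftrightarrow> tournament G \<and> trans (arcs_ends G)"

definition out_neighbourhood :: "('a, 'b) pre_digraph \<Rightarrow> 'a \<Rightarrow> 'a set" where
  "out_neighbourhood G v = {w. v \<rightarrow>\<^bsub>G\<^esub> w}"

definition locally_out_transitive :: "('a, 'b) pre_digraph \<Rightarrow> bool" where
  "locally_out_transitive G \<longleftrightarrow>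
     (\<forall>v\<in>verts G. transitive_tournament (G \<restriction> out_neighbourhood G v))"

definition acyclic_partition :: "('a, 'b) pre_digraph \<Rightarrow> 'a set set \<Rightarrow> bool" where
  "acyclic_partition G P \<longleftrightarrow>
     partition_on (verts G) P \<and> (\<forall>S\<in>P. acyclic_digraph (G \<restriction> S))"

(* The value is infinity iff there is no finite partition of this kind (Inf {} = \<infinity>). *)
definition dichromatic_number :: "('a, 'b) pre_digraph \<Rightarrow> enat" where
  "dichromatic_number G = Inf {enat (card P) | P. finite P \<and> acyclic_partition G P}"

lemma dichromatic_number_le_iff:
  "dichromatic_number G \<le> enat k \<longleftrightarrow>
     (\<exists>P. finite P \<and> card P \<le> k \<and> acyclic_partition G P)"
proof
  let ?A = "{enat (card P) | P. finite P \<and> acyclic_partition G P}"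
  assume *: "dichromatic_number G \<le> enat k"
  have "?A \<noteq> {}"
  proof
    assume "?A = {}"
    then have "dichromatic_number G = \<infinity>"
      unfolding dichromatic_number_def Inf_enat_def by (simp only: if_True refl)
    with * show False by simp
  qed
  then obtain a where "a \<in> ?A" by blast
  then have "Inf ?A \<in> ?A"
    unfolding Inf_enat_def using \<open>?A \<noteq> {}\<close> by (metis (mono_tags, lifting) LeastI)
  with * show "\<exists>P. finite P \<and> card P \<le> k \<and> acyclic_partition G P"
    unfolding dichromatic_number_def by auto
next
  assume "\<exists>P. finite P \<and> card P \<le> k \<and> acyclic_partition G P"
  then obtain P where "finite P" "card P \<le> k" "acyclic_partition G P" by blast
  then have "dichromatic_number G \<le> enat (card P)"
    unfolding dichromatic_number_def by (auto intro: Inf_lower)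
  also have "\<dots> \<le> enat k" using \<open>card P \<le> k\<close> by simp
  finally show "dichromatic_number G \<le> enat k" .
qed

lemma transitive_tournament_iff_acyclic:
  "transitive_tournament G \<longleftrightarrow> tournament G \<and> acyclic_digraph G"
proof (cases "tournament G")
  case True
  then interpret oriented_graph G by (simp add: tournament_def)
  have "trans (arcs_ends G) \<longleftrightarrow> acyclic_digraph G"
  proof
    assume tr: "trans (arcs_ends G)"
    show "acyclic_digraph G"
      unfolding acyclic_digraph_def
    proof
      assume "\<exists>p. cycle p"
      then obtain u p where "awalk u p u" "p \<noteq> []" by (auto simp: cycle_def)
      then have "u \<rightarrow>\<^sup>+\<^bsub>G\<^esub> u" by (metis reachable1_awalk)
      with tr have "u \<rightarrow>\<^bsub>G\<^esub> u" by (simp add: trancl_id)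
      then show False by (rule adj_not_same)
    qed
  next
    assume ac: "acyclic_digraph G"
    show "trans (arcs_ends G)"
    proof (rule transI)
      fix u v w assume uv: "u \<rightarrow>\<^bsub>G\<^esub> v" and vw: "v \<rightarrow>\<^bsub>G\<^esub> w"
      have "u \<noteq> w" using uv vw no_opposite_arcs by blast
      moreover have "\<not> w \<rightarrow>\<^bsub>G\<^esub> u"
      proof
        assume "w \<rightarrow>\<^bsub>G\<^esub> u"
        with uv vw have "u \<rightarrow>\<^sup>+\<^bsub>G\<^esub> u" by (meson trancl.simps)
        then obtain p where "awalk u p u" "p \<noteq> []" by (metis reachable1_awalk)
        then have "closed_w p" by (auto simp: closed_w_def)
        then show False using ac closed_w_imp_cycle by (auto simp: acyclic_digraph_def)
      qed
      ultimately show "u \<rightarrow>\<^bsub>G\<^esub> w"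
        using True uv vw adj_in_verts unfolding tournament_def by blast
    qed
  qed
  with True show ?thesis by (simp add: transitive_tournament_def)
qed (simp add: transitive_tournament_def)

end

theory Submission
  imports Defs "HOL-Analysis.Function_Topology"
begin

text \<open>
  By compactness the vertex set may be assumed finite. There one proves more, by induction: any
  prescribed transitive tournament \<open>T\<close> can be made monochromatic. The strong components can be
  coloured independently, so assume strong connectivity. Call a proper nonempty vertex set \<open>X\<close> an
  out-module if each vertex outside \<open>X\<close> is dominated by all of \<open>X\<close> or by none of it. The maximal
  out-modules (blocks) partition the vertex set, and sending a block \<open>X\<close> to the block that contains
  the source of its out-neighbourhood permutes the blocks in one cycle. Start with the block
  \<open>X\<close> that contains the source of \<open>T\<close> and let \<open>P\<close> be the union of the blocks met until the
  out-neighbourhood \<open>N\<close> of \<open>X\<close> is covered. Arcs leaving \<open>P\<close> end in a transitive tournament, and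
  arcs entering \<open>P\<close> end in \<open>X \<union> N\<close>. Now colour \<open>P\<close> with \<open>T \<inter> X\<close> and \<open>N\<close> in the first colour, and
  the complement with the out-neighbourhood of \<open>P\<close> in the second: no cycle of the first
  colour can leave \<open>P\<close>, and one of the second colour that enters \<open>P\<close> gets trapped in \<open>X\<close>.
\<close>

section \<open>Acyclic sets and transitive cliques of a relation\<close>

abbreviation acyclic_in :: "'a rel \<Rightarrow> 'a set \<Rightarrow> bool" where
  "acyclic_in E S \<equiv> acyclic (Restr E S)"

lemma acyclic_in_subset: "acyclic_in E B \<Longrightarrow> A \<subseteq> B \<Longrightarrow> acyclic_in E A"
  by (rule acyclic_subset) auto

text \<open>A walk that starts in \<open>A\<close> never leaves \<open>A\<close>, and one that ends
  outside \<open>A\<close> never visits it. So a closed walk lies in \<open>A\<close> or entirely in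
  \<open>B\<close>.\<close>

lemma acyclic_in_Un:
  assumes A: "acyclic_in E A" and B: "acyclic_in E B"
    and AB: "\<And>a b. a \<in> A \<Longrightarrow> b \<in> B - A \<Longrightarrow> (a, b) \<notin> E"
  shows "acyclic_in E (A \<union> B)"
proof (rule acyclicI, intro allI notI)
  let ?R = "Restr E (A \<union> B)"
  have stay: "(a, b) \<in> (Restr E A)\<^sup>+" if "(a, b) \<in> ?R\<^sup>+" "a \<in> A" for a b
    using that
  proof (induction rule: trancl_induct)
    case (base y)
    then show ?case using AB by blast
  next
    case (step y z)
    then have "y \<in> A" by (auto elim: tranclE)
    then show ?case using step AB by (blast intro: trancl_into_trancl)
  qed
  have avoid: "(a, b) \<in> (Restr E B)\<^sup>+" if "(a, b) \<in> ?R\<^sup>+" "b \<notin> A" for a b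
    using that
  proof (induction rule: converse_trancl_induct)
    case (base y)
    then show ?case using AB by blast
  next
    case (step y z)
    then have "z \<notin> A" using stay[of z b] by (auto elim: tranclE)
    then show ?case using step AB by (blast intro: trancl_into_trancl2)
  qed
  fix x assume "(x, x) \<in> ?R\<^sup>+"
  then show False using stay[of x x] avoid[of x x] A B unfolding acyclic_def by blast
qed

definition transitive_clique :: "'a rel \<Rightarrow> 'a set \<Rightarrow> bool" where
  "transitive_clique E T \<longleftrightarrow> total_on T E \<and> trans_on T E"

lemma transitive_clique_subset:
  "transitive_clique E T \<Longrightarrow> S \<subseteq> T \<Longrightarrow> transitive_clique E S"
  by (auto simp: transitive_clique_def intro: total_on_subset trans_on_subset)

lemma transitive_clique_source:
  assumes "finite T" "T \<noteq> {}" "transitive_clique E T"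
  shows "\<exists>s\<in>T. \<forall>x\<in>T - {s}. (s, x) \<in> E"
  using assms
proof (induction T rule: finite_ne_induct)
  case (insert a T)
  then obtain s where s: "s \<in> T" "\<And>x. x \<in> T - {s} \<Longrightarrow> (s, x) \<in> E"
    by (meson subset_insertI transitive_clique_subset)
  from insert.prems have tot: "total_on (insert a T) E" and tr: "trans_on (insert a T) E"
    by (auto simp: transitive_clique_def)
  have "(a, s) \<in> E \<or> (s, a) \<in> E"
    using tot insert.hyps s(1) by (auto simp: total_on_def)
  then show ?case
  proof
    assume as: "(a, s) \<in> E"
    have "(a, x) \<in> E" if "x \<in> T" for x
      using as s that trans_onD[OF tr, of a s x] by auto
    then show ?thesis by blast
  next
    assume "(s, a) \<in> E"
    then show ?thesis using s by blast
  qed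
qed simp

text \<open>The pair is ordered, so that a prescribed clique can be put in the first class; either
  class may be empty.\<close>

definition two_colouring :: "'a rel \<Rightarrow> 'a set \<Rightarrow> 'a set \<Rightarrow> 'a set \<Rightarrow> bool" where
  "two_colouring E V A B \<longleftrightarrow>
     A \<union> B = V \<and> A \<inter> B = {} \<and> acyclic_in E A \<and> acyclic_in E B"


section \<open>Blocks of a strongly connected relation\<close>

locale out_transitive =
  fixes E :: "'a rel"
  assumes asym: "asym E"
    and clique_out: "\<And>v. transitive_clique E (E `` {v})"

locale strong_out_transitive = out_transitive +
  fixes V :: "'a set"
  assumes finite_V: "finite V"
    and two_le_card: "2 \<le> card V"
    and strong: "\<And>S. S \<noteq> {} \<Longrightarrow> S \<subset> V \<Longrightarrow> E `` S \<inter> V - S \<noteq> {}"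
begin

section \<open>Out-modules and blocks\<close>

definition outn :: "'a set \<Rightarrow> 'a set" where
  "outn X = E `` X \<inter> V - X"

definition out_module :: "'a set \<Rightarrow> bool" where
  "out_module X \<longleftrightarrow> X \<noteq> {} \<and> X \<subset> V \<and> (\<forall>x\<in>X. \<forall>w\<in>outn X. (x, w) \<in> E)"

definition block :: "'a set \<Rightarrow> bool" where
  "block X \<longleftrightarrow> out_module X \<and> (\<forall>Y. out_module Y \<longrightarrow> X \<subseteq> Y \<longrightarrow> X = Y)"

lemma out_module_arc: "out_module X \<Longrightarrow> x \<in> X \<Longrightarrow> w \<in> outn X \<Longrightarrow> (x, w) \<in> E"
  by (auto simp: out_module_def)

lemma outn_nonempty: "out_module X \<Longrightarrow> outn X \<noteq> {}"
  using strong by (auto simp: out_module_def outn_def)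

lemma clique_outn:
  assumes "out_module X" shows "transitive_clique E (outn X)"
proof -
  obtain x where "x \<in> X" using assms by (auto simp: out_module_def)
  then have "outn X \<subseteq> E `` {x}" using assms out_module_arc by blast
  then show ?thesis using clique_out transitive_clique_subset by blast
qed

text \<open>A common vertex \<open>z\<close> dominates every out-neighbour of either set, so one
  outside the union is an out-neighbour of both. If the union were \<open>V\<close>, an
  out-neighbour of each set would lie in the other, giving opposite arcs.\<close>

lemma out_module_Un:
  assumes X: "out_module X" and Y: "out_module Y" and "X \<inter> Y \<noteq> {}"
  shows "out_module (X \<union> Y)"
proof -
  obtain z where z: "z \<in> X" "z \<in> Y" using assms by blast
  have "X \<union> Y \<noteq> V"
  proof
    assume V: "X \<union> Y = V"
    obtain w w' where w: "w \<in> outn X" and w': "w' \<in> outn Y"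
      using outn_nonempty X Y by blast
    then have "w \<in> Y" "w' \<in> X" using V by (auto simp: outn_def)
    then have "(w', w) \<in> E" "(w, w') \<in> E" using w w' X Y out_module_arc by auto
    then show False using asym by (auto dest: asymD)
  qed
  moreover have "(x, w) \<in> E" if "x \<in> X \<union> Y" "w \<in> outn (X \<union> Y)" for x w
  proof -
    have "w \<in> outn X \<or> w \<in> outn Y" using that by (auto simp: outn_def)
    then have "(z, w) \<in> E" using X Y z out_module_arc by blast
    then have "w \<in> outn X" "w \<in> outn Y" using that z by (auto simp: outn_def)
    then show ?thesis using that X Y out_module_arc by blast
  qed
  ultimately show ?thesis using X Y by (auto simp: out_module_def)
qed

lemma block_out_module: "block X \<Longrightarrow> out_module X"
  by (simp add: block_def)

lemma block_subset: "block X \<Longrightarrow> X \<subset> V"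
  by (simp add: block_def out_module_def)

lemma block_nonempty: "block X \<Longrightarrow> X \<noteq> {}"
  by (simp add: block_def out_module_def)

lemma block_eq:
  assumes "block X" "block Y" "x \<in> X" "x \<in> Y" shows "X = Y"
proof -
  have "out_module (X \<union> Y)" using assms out_module_Un block_def by blast
  then show ?thesis using assms unfolding block_def by blast
qed

lemma ex_block:
  assumes "v \<in> V" shows "\<exists>X. block X \<and> v \<in> X"
proof -
  have "{v} \<noteq> V" using two_le_card by auto
  then have "out_module {v}" using assms by (auto simp: out_module_def outn_def)
  moreover have "finite (Collect out_module)"
    by (rule finite_subset[of _ "Pow V"]) (auto simp: out_module_def finite_V)
  ultimately obtain X where "X \<in> Collect out_module" "{v} \<subseteq> X"
      "\<And>Y. Y \<in> Collect out_module \<Longrightarrow> X \<subseteq> Y \<Longrightarrow> X = Y"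
    using finite_has_maximal2[of "Collect out_module" "{v}"] by auto
  then show ?thesis unfolding block_def by auto
qed

section \<open>The successor map on blocks and its orbits\<close>

text \<open>The choice is forced: the source of \<open>outn X\<close> is unique by asymmetry, and
  blocks sharing a vertex coincide.\<close>

definition next_block :: "'a set \<Rightarrow> 'a set" where
  "next_block X = (SOME Y. block Y \<and> (\<exists>s\<in>outn X \<inter> Y. \<forall>w\<in>outn X - {s}. (s, w) \<in> E))"

lemma next_block_props:
  assumes "block X"
  shows "block (next_block X) \<and>
    (\<exists>s\<in>outn X \<inter> next_block X. \<forall>w\<in>outn X - {s}. (s, w) \<in> E)"
proof -
  have "finite (outn X)" by (rule finite_subset[OF _ finite_V]) (auto simp: outn_def)
  then obtain s where s: "s \<in> outn X" "\<forall>w\<in>outn X - {s}. (s, w) \<in> E"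
    using transitive_clique_source clique_outn outn_nonempty assms block_out_module by metis
  then obtain Y where "block Y" "s \<in> Y" using ex_block by (auto simp: outn_def)
  then show ?thesis unfolding next_block_def using s
    by (intro someI[where P = "\<lambda>Y. block Y \<and> (\<exists>s\<in>outn X \<inter> Y. \<forall>w\<in>outn X - {s}. (s, w) \<in> E)"]) auto
qed

lemma outn_subset_next:
  assumes "block X" shows "outn X \<subseteq> next_block X \<union> outn (next_block X)"
  using next_block_props[OF assms] by (auto simp: outn_def)

lemma outn_meets_next: "block X \<Longrightarrow> outn X \<inter> next_block X \<noteq> {}"
  using next_block_props by blast

lemma block_funpow: "block X \<Longrightarrow> block ((next_block ^^ n) X)"
  by (induction n) (auto simp: next_block_props)

text \<open>Iterates the one-step inclusion: an out-neighbour of a block stays an out-neighbour of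
  the successors until one of them absorbs it.\<close>

lemma outn_funpow:
  assumes "block X" "w \<in> outn ((next_block ^^ i) X)" "i \<le> n"
  shows "w \<in> outn ((next_block ^^ n) X) \<or> (\<exists>j. i < j \<and> j \<le> n \<and> w \<in> (next_block ^^ j) X)"
  using assms(3)
proof (induction n rule: dec_induct)
  case base
  then show ?case using assms by simp
next
  case (step n)
  have next_sub: "outn ((next_block ^^ n) X) \<subseteq> (next_block ^^ Suc n) X \<union> outn ((next_block ^^ Suc n) X)"
    using outn_subset_next block_funpow assms(1) by simp
  have "i < Suc n" using step.hyps by simp
  from step.IH show ?case
  proof
    assume "w \<in> outn ((next_block ^^ n) X)"
    then show ?thesis using next_sub \<open>i < Suc n\<close> by blast
  next
    assume "\<exists>j. i < j \<and> j \<le> n \<and> w \<in> (next_block ^^ j) X"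
    then show ?thesis using le_SucI by blast
  qed
qed

text \<open>If the orbit missed a vertex, its union would be an out-module: an out-neighbour of one
  block is never absorbed, so going round the cycle every block dominates it. Maximality of
  \<open>Y\<close> would make \<open>Y\<close> the whole union, yet the next block meets
  \<open>outn Y\<close>.\<close>

lemma periodic_orbit_covers:
  assumes Y: "block Y" and m: "0 < m" "(next_block ^^ m) Y = Y"
  shows "(\<Union>j<m. (next_block ^^ j) Y) = V"
proof (rule ccontr)
  let ?U = "\<Union>j<m. (next_block ^^ j) Y"
  assume neq: "?U \<noteq> V"
  have per: "(next_block ^^ (n mod m)) Y = (next_block ^^ n) Y" for n
    using m(2) by (rule funpow_mod_eq)
  have sub: "(next_block ^^ n) Y \<subseteq> ?U" for n
    using per[of n] m(1) by (metis UN_upper lessThan_iff mod_less_divisor)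
  have "?U \<subseteq> V" using block_subset block_funpow Y by blast
  moreover have "?U \<noteq> {}" using sub[of 0] block_nonempty[OF Y] by (metis funpow_0 subset_empty)
  moreover have "(x, w) \<in> E" if x: "x \<in> ?U" and w: "w \<in> outn ?U" for x w
  proof -
    from w have "w \<notin> ?U" by (simp add: outn_def)
    from w obtain y i where y: "y \<in> (next_block ^^ i) Y" "(y, w) \<in> E"
      by (auto simp: outn_def)
    then have wi: "w \<in> outn ((next_block ^^ i) Y)" using w sub[of i] by (auto simp: outn_def)
    from x obtain j where j: "x \<in> (next_block ^^ j) Y" by blast
    \<comment> \<open>Congruent to \<open>j\<close> modulo \<open>m\<close>, so it gives the same
      block, and at least \<open>i\<close>, so \<open>outn_funpow\<close> applies from block
      \<open>i\<close> on.\<close>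
    let ?n = "j + m * i"
    have n: "(next_block ^^ ?n) Y = (next_block ^^ j) Y"
      using per[of ?n] per[of j] by simp
    have "i \<le> ?n" using m(1) by (simp add: trans_le_add2)
    then have "w \<in> outn ((next_block ^^ ?n) Y)"
      using outn_funpow[OF Y wi] sub \<open>w \<notin> ?U\<close> by blast
    then show ?thesis using n j out_module_arc block_funpow block_out_module Y by metis
  qed
  ultimately have "out_module ?U" using neq by (auto simp: out_module_def)
  then have "Y = ?U" using Y sub[of 0] by (auto simp: block_def)
  then have "next_block Y \<subseteq> Y" using sub[of 1] by simp
  then show False using outn_meets_next[OF Y] by (auto simp: outn_def)
qed

text \<open>Finiteness makes the orbit eventually periodic. The periodic part covers
  \<open>V\<close>, so one of its blocks meets \<open>X\<close> and hence equals
  \<open>X\<close>.\<close>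

lemma orbit_returns:
  assumes X: "block X" shows "\<exists>m>0. (next_block ^^ m) X = X"
proof -
  have "range (\<lambda>n. (next_block ^^ n) X) \<subseteq> Pow V" using block_funpow[OF X] block_subset by blast
  then have "finite (range (\<lambda>n. (next_block ^^ n) X))"
    by (rule finite_subset) (simp add: finite_V)
  then have "\<not> inj (\<lambda>n. (next_block ^^ n) X)"
    using finite_imageD infinite_UNIV_nat by blast
  then obtain i j where ij: "i < j" "(next_block ^^ i) X = (next_block ^^ j) X"
    unfolding inj_def by (metis linorder_neqE_nat)
  let ?Y = "(next_block ^^ i) X"
  have jY: "(next_block ^^ (j - i)) ?Y = ?Y"
    using ij by (metis add.commute funpow_add comp_apply le_add_diff_inverse less_imp_le)
  then have cover: "(\<Union>l<j - i. (next_block ^^ l) ?Y) = V"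
    using periodic_orbit_covers block_funpow[OF X] ij by simp
  obtain x where x: "x \<in> X" using block_nonempty X by blast
  then have "x \<in> V" using block_subset X by blast
  then obtain l where "x \<in> (next_block ^^ l) ?Y" using cover by blast
  then have l: "x \<in> (next_block ^^ (l + i)) X" by (simp add: funpow_add)
  then have eq: "(next_block ^^ (l + i)) X = X"
    using block_eq X block_funpow x by metis
  show ?thesis
  \<comment> \<open>Index \<open>0\<close> gives no positive period; but then \<open>i = 0\<close>,
    and \<open>j - i\<close> is a period of \<open>X\<close> itself.\<close>
  proof (cases "l + i = 0")
    case True
    then show ?thesis using jY ij by auto
  next
    case False
    then show ?thesis using eq by blast
  qed
qed

section \<open>Cutting the vertex set along the cycle of blocks\<close>

text \<open>Provides the cut along which colourings of \<open>P\<close> and \<open>V - P\<close> are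
  glued. \<open>P\<close> is the shortest initial stretch of the block cycle from \<open>X\<close>
  that covers \<open>outn X\<close>.\<close>

lemma split_at_block:
  assumes X: "block X"
  shows "\<exists>P. X \<union> outn X \<subseteq> P \<and> P \<subset> V \<and> transitive_clique E (outn P) \<and>
     E `` (V - P) \<inter> P \<subseteq> X \<union> outn X"
proof -
  let ?B = "\<lambda>n. (next_block ^^ n) X"
  have B: "block (?B n)" for n using block_funpow X by blast
  define m where "m = (LEAST m. 0 < m \<and> ?B m = X)"
  have m: "0 < m" "?B m = X"
    using LeastI_ex[OF orbit_returns[OF X]] by (auto simp: m_def)
  have min_m: "?B n \<noteq> X" if "0 < n" "n < m" for n
    using that not_less_Least unfolding m_def by blast
  have cover: "(\<Union>j<m. ?B j) = V" using periodic_orbit_covers X m by blast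
  \<comment> \<open>If they were equal, \<open>m - j\<close> more steps would bring block
    \<open>i\<close> to \<open>X\<close> before the minimal period.\<close>
  have dist: "?B i \<noteq> ?B j" if "i < j" "j < m" for i j
  proof
    assume "?B i = ?B j"
    then have "(next_block ^^ (m - j)) (?B i) = (next_block ^^ (m - j)) (?B j)" by simp
    then have "?B (m - j + i) = ?B (m - j + j)" by (simp only: funpow_add comp_apply)
    then have "?B (m - j + i) = X" using that m by simp
    with min_m[of "m - j + i"] that show False by linarith
  qed
  define k where "k = (LEAST k. outn X \<subseteq> (\<Union>j\<le>k. ?B j))"
  have "outn X \<subseteq> (\<Union>j\<le>m - 1. ?B j)"
  proof -
    have "{..m - 1} = {..<m}" using m(1) by auto
    then show ?thesis using cover by (simp add: outn_def) blast
  qed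
  then have k: "outn X \<subseteq> (\<Union>j\<le>k. ?B j)" and km: "k \<le> m - 1"
    unfolding k_def by (fact LeastI, fact Least_le)
  have min_k: "\<not> outn X \<subseteq> (\<Union>j\<le>i. ?B j)" if "i < k" for i
    using that not_less_Least unfolding k_def by blast
  let ?P = "\<Union>j\<le>k. ?B j"
  have XP: "X \<subseteq> ?P" using UN_upper[of 0 "{..k}" ?B] by simp
  have hit: "\<exists>w\<in>outn X. w \<in> ?B k"
  proof (cases k)
    case 0
    then have "outn X \<subseteq> X" using k by simp
    then have "outn X = {}" by (auto simp: outn_def)
    then show ?thesis using outn_nonempty[OF block_out_module[OF X]] by simp
  next
    case (Suc i)
    then show ?thesis using min_k[of i] k by (auto simp: atMost_Suc)
  qed
  \<comment> \<open>Otherwise block \<open>m - 1\<close> is the last block of \<open>P\<close>. It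
    contains an out-neighbour \<open>w\<close> of \<open>X\<close>, and its successor
    \<open>X\<close> contains an out-neighbour \<open>s\<close> of it, so \<open>w\<close> and
    \<open>s\<close> dominate each other.\<close>
  have ne: "?P \<noteq> V"
  proof
    assume PV: "?P = V"
    obtain x where x: "x \<in> ?B (m - 1)" using B block_nonempty by blast
    then have "x \<in> ?P" using PV B block_subset by blast
    then obtain i where i: "i \<le> k" "x \<in> ?B i" by blast
    then have "?B i = ?B (m - 1)" using x B block_eq by blast
    then have "k = m - 1" using dist[of i "m - 1"] i km m(1) by (cases "i = m - 1") auto
    then obtain w where w: "w \<in> outn X" "w \<in> ?B (m - 1)" using hit by auto
    have "next_block (?B (m - 1)) = X" using m by (metis Suc_diff_1 funpow.simps(2) comp_apply)
    then obtain s where s: "s \<in> outn (?B (m - 1))" "s \<in> X"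
      using outn_meets_next[OF B, of "m - 1"] by auto
    have "(w, s) \<in> E" using s w B block_out_module out_module_arc by blast
    moreover have "(s, w) \<in> E" using s w X block_out_module out_module_arc by blast
    ultimately show False using asym by (auto dest: asymD)
  qed
  have sub: "?P \<subseteq> V" using B block_subset by blast
  \<comment> \<open>A vertex outside \<open>P\<close> is not absorbed by any block up to
    \<open>k\<close>.\<close>
  have "outn ?P \<subseteq> outn (?B k)"
  proof
    fix w assume w: "w \<in> outn ?P"
    then obtain i y where i: "i \<le> k" "y \<in> ?B i" "(y, w) \<in> E" by (auto simp: outn_def)
    then have "w \<in> outn (?B i)" using w by (auto simp: outn_def)
    then show "w \<in> outn (?B k)"
      using outn_funpow[OF X _ i(1)] w by (auto simp: outn_def)
  qed
  then have clique: "transitive_clique E (outn ?P)"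
    using clique_outn[OF block_out_module[OF B]] transitive_clique_subset by blast
  have enter: "p \<in> X \<union> outn X" if q: "q \<in> V - ?P" and p: "p \<in> ?P" and qp: "(q, p) \<in> E" for p q
  proof -
    obtain j where j: "j < m" "q \<in> ?B j" using q cover by blast
    then have "k < j" using q by force
    obtain i where i: "i \<le> k" "p \<in> ?B i" using p by blast
    have notin: "p \<notin> ?B n" if "k < n" "n < m" for n
      using dist[of i n] i that block_eq[OF B[of i] B[of n]] by auto
    have "p \<in> V" using i B block_subset by blast
    then have "p \<in> outn (?B j)" using notin \<open>k < j\<close> j qp by (auto simp: outn_def)
    \<comment> \<open>Follow \<open>p\<close> from block \<open>j\<close> to block \<open>m\<close>,
      which is \<open>X\<close> again. It lies in no block strictly between \<open>k\<close> and
      \<open>m\<close>, so only \<open>X\<close> can absorb it.\<close>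
    from outn_funpow[OF X this, of m] j(1) m(2)
    have "p \<in> outn X \<or> (\<exists>n. j < n \<and> n \<le> m \<and> p \<in> ?B n)" by auto
    then show ?thesis
    proof
      assume "\<exists>n. j < n \<and> n \<le> m \<and> p \<in> ?B n"
      then obtain n where "j < n" "n \<le> m" "p \<in> ?B n" by blast
      then show ?thesis using notin[of n] \<open>k < j\<close> m(2) by (cases "n = m") auto
    qed simp
  qed
  have "E `` (V - ?P) \<inter> ?P \<subseteq> X \<union> outn X"
  proof
    fix p assume "p \<in> E `` (V - ?P) \<inter> ?P"
    then obtain q where "q \<in> V - ?P" "p \<in> ?P" "(q, p) \<in> E" by blast
    then show "p \<in> X \<union> outn X" by (rule enter)
  qed
  then show ?thesis using k XP ne sub clique by (intro exI[of _ ?P] conjI psubsetI Un_least)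
qed

end


section \<open>Finite vertex sets\<close>

context out_transitive
begin

text \<open>Prescribing a clique is what makes the gluing possible: in the strong case the induction
  hypothesis is applied to \<open>P\<close> with a clique containing \<open>outn X\<close>, and to
  \<open>V - P\<close> with \<open>outn P\<close>.\<close>

lemma finite_two_colouring:
  assumes "finite V" "T \<subseteq> V" "transitive_clique E T"
  shows "\<exists>A B. two_colouring E V A B \<and> T \<subseteq> A"
  using assms
proof (induction "card V" arbitrary: V T rule: less_induct)
  case less
  note fin = \<open>finite V\<close>
  have smaller: "\<exists>A B. two_colouring E S A B \<and> T' \<subseteq> A"
    if "S \<subset> V" "T' \<subseteq> S" "transitive_clique E T'" for S T'
    using less.hyps[of S T'] that fin psubset_card_mono finite_subset by blast
  have irr: "(x, x) \<notin> E" for x using asym by (auto dest: asymD)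
  consider "card V < 2" | S where "S \<noteq> {}" "S \<subset> V" "E `` S \<inter> V - S = {}"
    | "2 \<le> card V" "\<And>S. S \<noteq> {} \<Longrightarrow> S \<subset> V \<Longrightarrow> E `` S \<inter> V - S \<noteq> {}"
    by (meson linorder_not_le)
  then show ?case
  proof cases
    case 1
    then have "V = {} \<or> (\<exists>x. V = {x})"
      using fin by (metis One_nat_def Suc_1 card_0_eq card_1_singletonE less_2_cases)
    then have "Restr E V = {}" using irr by auto
    then have "two_colouring E V V {}" by (simp add: two_colouring_def acyclic_def)
    then show ?thesis using less.prems by blast
  next
    case 2
    have "V - S \<subset> V" using 2 by blast
    obtain A B where AB: "two_colouring E S A B" "T \<inter> S \<subseteq> A"
      using smaller[of S "T \<inter> S"] 2 less.prems transitive_clique_subset by blast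
    obtain A' B' where AB': "two_colouring E (V - S) A' B'" "T - S \<subseteq> A'"
      using smaller[of "V - S" "T - S"] \<open>V - S \<subset> V\<close> less.prems transitive_clique_subset by blast
    have *: "A \<union> B = S" "A \<inter> B = {}" "A' \<union> B' = V - S" "A' \<inter> B' = {}"
      using AB AB' by (auto simp: two_colouring_def)
    \<comment> \<open>No arc leads from \<open>S\<close> to \<open>V - S\<close>, so any class of
      \<open>S\<close> can be joined with any class of \<open>V - S\<close>.\<close>
    have "acyclic_in E (A \<union> A')" "acyclic_in E (B \<union> B')"
      using AB AB' * 2 by (auto intro!: acyclic_in_Un simp: two_colouring_def)
    then have "two_colouring E V (A \<union> A') (B \<union> B')"
      using * 2 unfolding two_colouring_def by blast
    then show ?thesis using AB AB' by blast
  next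
    case 3
    interpret strong_out_transitive E V
      by unfold_locales (use fin 3 in auto)
    \<comment> \<open>\<open>t\<close> is the source of \<open>T\<close>, or an arbitrary vertex if
      \<open>T\<close> is empty.\<close>
    have "\<exists>t\<in>V. T \<subseteq> {t} \<union> E `` {t}"
    proof (cases "T = {}")
      case True
      then show ?thesis using 3 by fastforce
    next
      case False
      then obtain t where "t \<in> T" "\<forall>x\<in>T - {t}. (t, x) \<in> E"
        using transitive_clique_source less.prems finite_subset by metis
      then show ?thesis using less.prems by blast
    qed
    then obtain t where t: "t \<in> V" "T \<subseteq> {t} \<union> E `` {t}" by blast
    obtain X where X: "block X" "t \<in> X" using ex_block t by blast
    have TX: "T \<subseteq> X \<union> outn X" using t X less.prems by (auto simp: outn_def)
    obtain P where P: "X \<union> outn X \<subseteq> P" "P \<subset> V" "transitive_clique E (outn P)"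
      "E `` (V - P) \<inter> P \<subseteq> X \<union> outn X"
      using split_at_block[OF X(1)] by blast
    \<comment> \<open>This contains \<open>T\<close>, and it is a clique because all of
      \<open>X\<close> dominates \<open>outn X\<close>.\<close>
    let ?T = "(T \<inter> X) \<union> outn X"
    have arc: "(x, w) \<in> E" "(w, x) \<notin> E" if "x \<in> X" "w \<in> outn X" for x w
      using out_module_arc[OF block_out_module[OF X(1)] that] asym by (auto dest: asymD)
    have cl: "transitive_clique E (T \<inter> X)" "transitive_clique E (outn X)"
      using less.prems transitive_clique_subset X clique_outn block_out_module by blast+
    have clT: "transitive_clique E ?T"
      unfolding transitive_clique_def
    proof
      show "total_on ?T E" using cl arc by (auto simp: transitive_clique_def total_on_def)
      show "trans_on ?T E"
      proof (rule trans_onI)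
        fix a b c
        assume abc: "a \<in> ?T" "b \<in> ?T" "c \<in> ?T" "(a, b) \<in> E" "(b, c) \<in> E"
        consider "a \<in> T \<inter> X" "b \<in> T \<inter> X" "c \<in> T \<inter> X" | "a \<in> X" "c \<in> outn X"
          | "a \<in> outn X" "b \<in> outn X" "c \<in> outn X"
          using abc arc by blast
        then show "(a, c) \<in> E"
          using cl abc arc by cases (auto simp: transitive_clique_def dest: trans_onD)
      qed
    qed
    obtain A B where AB: "two_colouring E P A B" "?T \<subseteq> A"
      using smaller[of P ?T] P clT by blast
    have "t \<in> P" using X(2) P(1) by blast
    then have "V - P \<subset> V" using t(1) by blast
    moreover have "outn P \<subseteq> V - P" by (auto simp: outn_def)
    \<comment> \<open>The names are swapped: the class containing \<open>outn P\<close> is to be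
      joined with \<open>B\<close>, not with \<open>A\<close>.\<close>
    ultimately obtain B' A' where AB': "two_colouring E (V - P) B' A'" "outn P \<subseteq> B'"
      using smaller[OF _ _ P(3)] by blast
    have *: "A \<union> B = P" "A \<inter> B = {}" "A' \<union> B' = V - P" "A' \<inter> B' = {}"
      and ac: "acyclic_in E A" "acyclic_in E B" "acyclic_in E A'" "acyclic_in E B'"
      using AB AB' by (auto simp: two_colouring_def)
    have "acyclic_in E (A \<union> A')"
    proof (rule acyclic_in_Un[OF ac(1,3)])
      fix a b assume "a \<in> A" "b \<in> A' - A"
      then show "(a, b) \<notin> E" using AB' * by (auto simp: outn_def)
    qed
    \<comment> \<open>As \<open>outn X\<close> is in \<open>A\<close>, arcs from \<open>B'\<close>
      to \<open>B\<close> end in \<open>B \<inter> X\<close>, and no arc leads from there to the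
      rest of the class. The pieces can therefore be added one at a time.\<close>
    moreover have "acyclic_in E (B \<inter> X \<union> ((B - X) \<union> B'))"
    proof (rule acyclic_in_Un)
      show "acyclic_in E (B \<inter> X)" using ac acyclic_in_subset by blast
      have "acyclic_in E (B' \<union> (B - X))"
      proof (rule acyclic_in_Un[OF ac(4)])
        show "acyclic_in E (B - X)" using ac acyclic_in_subset by blast
        fix a b assume "a \<in> B'" "b \<in> B - X - B'"
        then have "a \<in> V - P" "b \<in> P" "b \<notin> X" "b \<notin> outn X" using * AB(2) by auto
        then show "(a, b) \<notin> E" using P(4) by auto
      qed
      then show "acyclic_in E (B - X \<union> B')" by (simp add: Un_commute)
      fix a b assume ab: "a \<in> B \<inter> X" "b \<in> B - X \<union> B' - B \<inter> X"
      then have "b \<in> V - X" "b \<notin> outn X" using * AB(2) P by auto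
      then show "(a, b) \<notin> E" using ab by (auto simp: outn_def)
    qed
    then have "acyclic_in E (B \<union> B')" by (rule acyclic_in_subset) auto
    ultimately have "two_colouring E V (A \<union> A') (B \<union> B')"
      using * P unfolding two_colouring_def by blast
    moreover have "T \<subseteq> A \<union> A'" using TX AB(2) by blast
    ultimately show ?thesis by blast
  qed
qed

end


section \<open>Compactness\<close>

lemma trancl_finite_subset:
  assumes "(a, b) \<in> R\<^sup>+" shows "\<exists>F\<subseteq>R. finite F \<and> (a, b) \<in> F\<^sup>+"
  using assms
proof (induction rule: trancl_induct)
  case (base y)
  then show ?case by (intro exI[of _ "{(a, y)}"]) auto
next
  case (step y z)
  then obtain F where "F \<subseteq> R" "finite F" "(a, y) \<in> F\<^sup>+" by blast
  then show ?case using step(2)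
    by (intro exI[of _ "insert (y, z) F"])
      (auto intro: trancl_into_trancl trancl_mono_subset[THEN subsetD, OF subset_insertI])
qed

lemma acyclic_in_finite_character:
  assumes "\<And>S. finite S \<Longrightarrow> S \<subseteq> A \<Longrightarrow> acyclic_in E S"
  shows "acyclic_in E A"
proof (rule acyclicI, intro allI notI)
  fix x assume "(x, x) \<in> (Restr E A)\<^sup>+"
  then obtain F where F: "F \<subseteq> Restr E A" "finite F" "(x, x) \<in> F\<^sup>+"
    using trancl_finite_subset by metis
  have "F \<subseteq> Restr E (Field F)" using F(1) by (auto simp: Field_def)
  then have "(x, x) \<in> (Restr E (Field F))\<^sup>+" using F(3) trancl_mono by blast
  moreover have "acyclic_in E (Field F)"
  proof (rule assms)
    show "finite (Field F)" using F(2) by (rule finite_Field)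
    show "Field F \<subseteq> A" using F(1) by (auto simp: Field_def)
  qed
  ultimately show False by (auto simp: acyclic_def)
qed

lemma compact_UNIV_bool_fun: "compact (UNIV :: ('a \<Rightarrow> bool) set)"
proof -
  have "compact_space (euclidean :: bool topology)"
    by (simp add: compact_space_def finite_imp_compact)
  then have "compact_space (product_topology (\<lambda>_::'a. euclidean :: bool topology) UNIV)"
    by (simp add: compact_space_product_topology)
  then show ?thesis
    by (simp add: compact_space_def euclidean_product_topology)
qed

text \<open>\<open>P\<close> depends on finitely many coordinates only, and the functions agreeing
  with a given one on \<open>S\<close> form an open cylinder, so the complement is open.\<close>

lemma closed_restriction:
  assumes "finite S" "\<And>f g :: 'a \<Rightarrow> bool. (\<And>x. x \<in> S \<Longrightarrow> f x = g x) \<Longrightarrow> P f \<Longrightarrow> P g"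
  shows "closed {f. P f}"
proof -
  have "open {f. \<not> P f}"
  proof (subst open_subopen, intro ballI)
    fix f assume f: "f \<in> {f. \<not> P f}"
    let ?N = "\<Inter>x\<in>S. {g. g x = f x}"
    have "open {g :: 'a \<Rightarrow> bool. g x = f x}" for x
    proof -
      have "open ((\<lambda>g :: 'a \<Rightarrow> bool. g x) -` {f x})"
        by (intro open_vimage) (auto intro: open_discrete continuous_on_product_coordinates)
      then show ?thesis by (simp add: vimage_def)
    qed
    then have "open ?N" using assms(1) by (intro open_INT) auto
    moreover have "?N \<subseteq> {f. \<not> P f}"
    proof
      fix g assume "g \<in> ?N"
      then show "g \<in> {f. \<not> P f}" using f assms(2)[of g f] by auto
    qed
    ultimately show "\<exists>N. open N \<and> f \<in> N \<and> N \<subseteq> {f. \<not> P f}" by (intro exI[of _ ?N]) auto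
  qed
  then show ?thesis by (simp add: closed_def Compl_eq)
qed

text \<open>Colourings are points of a compact product space. Those good on a given finite set form
  a closed set, and a colouring of the union of finitely many such sets is good on each of
  them.\<close>

lemma two_colouring_compactness:
  assumes "\<And>S. finite S \<Longrightarrow> S \<subseteq> V \<Longrightarrow> \<exists>A B. two_colouring E S A B"
  shows "\<exists>A B. two_colouring E V A B"
proof -
  define good where
    "good S f \<longleftrightarrow> acyclic_in E {x \<in> S. f x} \<and> acyclic_in E {x \<in> S. \<not> f x}" for S f
  let ?I = "{S. finite S \<and> S \<subseteq> V}"
  have "UNIV \<inter> (\<Inter>S\<in>?I. {f. good S f}) \<noteq> {}"
  proof (rule compact_imp_fip_image[OF compact_UNIV_bool_fun])
    fix S assume "S \<in> ?I"
    then show "closed {f. good S f}"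
    proof (intro closed_restriction[of S])
      fix f g :: "'a \<Rightarrow> bool" assume "\<And>x. x \<in> S \<Longrightarrow> f x = g x" "good S f"
      then have "{x \<in> S. f x} = {x \<in> S. g x}" "{x \<in> S. \<not> f x} = {x \<in> S. \<not> g x}" by auto
      with \<open>good S f\<close> show "good S g" by (simp add: good_def)
    qed simp
  next
    fix I' assume I': "finite I'" "I' \<subseteq> ?I"
    then have "finite (\<Union>I')" "\<Union>I' \<subseteq> V" by auto
    then obtain A B where AB: "two_colouring E (\<Union>I') A B" using assms by blast
    have "good S (\<lambda>x. x \<in> A)" if "S \<in> I'" for S
      unfolding good_def
    proof
      show "acyclic_in E {x \<in> S. x \<in> A}"
        using AB by (auto simp: two_colouring_def intro: acyclic_in_subset[of E A])
      show "acyclic_in E {x \<in> S. x \<notin> A}"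
        using AB that by (auto simp: two_colouring_def intro!: acyclic_in_subset[of E B])
    qed
    then show "UNIV \<inter> (\<Inter>S\<in>I'. {f. good S f}) \<noteq> {}" by blast
  qed
  then obtain f where f: "\<And>S. finite S \<Longrightarrow> S \<subseteq> V \<Longrightarrow> good S f" by auto
  have "acyclic_in E {x \<in> V. f x}"
  proof (rule acyclic_in_finite_character)
    fix S assume S: "finite S" "S \<subseteq> {x \<in> V. f x}"
    then have "good S f" using f by auto
    moreover have "{x \<in> S. f x} = S" using S by auto
    ultimately show "acyclic_in E S" by (simp add: good_def)
  qed
  moreover have "acyclic_in E {x \<in> V. \<not> f x}"
  proof (rule acyclic_in_finite_character)
    fix S assume S: "finite S" "S \<subseteq> {x \<in> V. \<not> f x}"
    then have "good S f" using f by auto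
    moreover have "{x \<in> S. \<not> f x} = S" using S by auto
    ultimately show "acyclic_in E S" by (simp add: good_def)
  qed
  ultimately have "two_colouring E V {x \<in> V. f x} {x \<in> V. \<not> f x}"
    by (auto simp: two_colouring_def)
  then show ?thesis by blast
qed


section \<open>Digraphs\<close>

lemma arcs_ends_induce_subgraph: "arcs_ends (G \<restriction> S) = Restr (arcs_ends G) S"
  by (auto simp: arcs_ends_def arc_to_ends_def)

lemma (in wf_digraph) acyclic_digraph_induce:
  assumes "acyclic_in (arcs_ends G) S" shows "acyclic_digraph (G \<restriction> S)"
  unfolding acyclic_digraph_def
proof
  interpret S: wf_digraph "G \<restriction> S" by (rule wellformed_induce_subgraph)
  assume "\<exists>p. S.cycle p"
  then obtain u p where "S.awalk u p u" "p \<noteq> []" by (auto simp: S.cycle_def)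
  then have "u \<rightarrow>\<^sup>+\<^bsub>G \<restriction> S\<^esub> u" by (metis S.reachable1_awalk)
  with assms show False by (simp add: arcs_ends_induce_subgraph acyclic_def)
qed

lemma (in oriented_graph) out_transitive_arcs_ends:
  assumes "locally_out_transitive G" shows "out_transitive (arcs_ends G)"
proof
  show "asym (arcs_ends G)" using no_opposite_arcs by (auto intro: asymI)
  fix v
  let ?N = "arcs_ends G `` {v}"
  show "transitive_clique (arcs_ends G) ?N"
  proof (cases "v \<in> verts G")
    case True
    have "out_neighbourhood G v = ?N" by (auto simp: out_neighbourhood_def)
    with True assms have "transitive_tournament (G \<restriction> ?N)"
      by (auto simp: locally_out_transitive_def)
    then show ?thesis
      unfolding transitive_tournament_def tournament_def arcs_ends_induce_subgraph
        transitive_clique_def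
      by (auto simp: total_on_def intro!: trans_onI dest: transD)
  next
    case False
    then have "?N = {}" using adj_in_verts by auto
    then show ?thesis by (simp add: transitive_clique_def trans_on_def)
  qed
qed

theorem theorem8p4p2:
  fixes G :: "('a, 'b) pre_digraph"
  assumes "oriented_graph G"
    and "locally_out_transitive G"
  shows "dichromatic_number G \<le> 2"
proof -
  interpret oriented_graph G by fact
  interpret out_transitive "arcs_ends G" by (rule out_transitive_arcs_ends) fact
  have "\<exists>A B. two_colouring (arcs_ends G) (verts G) A B"
  proof (rule two_colouring_compactness)
    fix S :: "'a set" assume "finite S"
    then show "\<exists>A B. two_colouring (arcs_ends G) S A B"
      using finite_two_colouring[of S "{}"] by (auto simp: transitive_clique_def trans_on_def)
  qed
  then obtain A B where AB: "two_colouring (arcs_ends G) (verts G) A B" by blast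
  \<comment> \<open>Parts of a partition are nonempty, so an empty colour class is dropped.\<close>
  let ?P = "{A, B} - {{}}"
  have "partition_on (verts G) ?P"
    using AB by (auto simp: partition_on_def two_colouring_def disjoint_def)
  then have "acyclic_partition G ?P"
    using AB acyclic_digraph_induce by (auto simp: acyclic_partition_def two_colouring_def)
  moreover have "card ?P \<le> 2"
    using card_mono[of "{A, B}" ?P] card_insert_le_m1[of 2 "{B}" A] by auto
  ultimately have "dichromatic_number G \<le> enat 2"
    unfolding dichromatic_number_le_iff by (intro exI[of _ ?P]) auto
  then show ?thesis by (simp add: numeral_eq_enat)
qed

end
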